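(* Let $(Q,\cdot,\backslash,/)$ be a middle Bol loop and let $f_1,g_1,f_2,g_2:Q^2\to Q$ be defined by $$f_1(x,y)=(yx)\backslash x\ \text{ or }\ x\backslash(y\backslash x),\qquad g_1(x,y)=(xy)\backslash x\ \text{ or }\ x\backslash(x/y),$$ $$f_2(x,y)=x/(xy)\ \text{ or }\ (x/y)/x,\qquad g_2(x,y)=x/(yx)\ \text{ or }\ (y\backslash x)/x.$$ Then, for all $x,y,z,u\in Q$ (each of the characterising identities in (g), (j), (l), (n), (p), (r), (t), (v), (x) being required for all $x,y\in Q$): (a) $x/(yx)=(y\backslash x)/x$. (b) $z(yx)=x\Leftrightarrow y(zx)=x$; and $L_yL_z=I\Leftrightarrow L_zL_y=I$. (c) $x/(xz)=(x/z)/x$. (d) $(yx)u=x\Leftrightarrow y(xu)=x$; and $R_uL_y=I\Leftrightarrow L_yR_u=I$. (e) $f_2(x,y)=x/(xy)\Leftrightarrow f_2(x,y)=(x/y)/x$. (f) $g_2(x,y)=x/(yx)\Leftrightarrow g_2(x,y)=(y\backslash x)/x$. (g) The following are equivalent: 1. $(Q,/)\equiv(Q,\backslash)$; 2. $[x/(xy)]x=[y/(xy)]y$; 3. $x[(xy)\backslash x]=[y/(xy)]y$; 4. $[x/(xy)]x=y[(xy)\backslash y]$; 5. $x[(xy)\backslash x]=y[(xy)\backslash y]$. (i) $(yx)z=x\Leftrightarrow xz=[x/(yx)]x\Leftrightarrow y(xz)=x$. (j) $(Q,\cdot)$ is a CIPL if and only if $xy^{-1}=[x/(yx)]x$. (k)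 $(yx)z=x\Leftrightarrow xz=g_2(x,y)\cdot x\Leftrightarrow y(xz)=x$. (l) $(Q,\cdot)$ is a CIPL if and only if $xy^{-1}=g_2(x,y)\cdot x$. (m) $z(xy)=x\Leftrightarrow zx=x[(xy)\backslash x]\Leftrightarrow (zx)y=x$. (n) $(Q,\cdot)$ is a CIPL if and only if $y^{-1}x=x[(xy)\backslash x]$. (o) $z(xy)=x\Leftrightarrow zx=x\cdot g_1(x,y)$. (p) $(Q,\cdot)$ is a CIPL if and only if $y^{-1}x=x\cdot g_1(x,y)$. (q) $z(yx)=x\Leftrightarrow zx=x[(yx)\backslash x]\Leftrightarrow y(zx)=x$. (r) $(Q,\cdot)$ is a LIPL if and only if $y^{-1}x=x[(yx)\backslash x]$. (s) $z(yx)=x\Leftrightarrow zx=x\cdot f_1(x,y)$. (t) $(Q,\cdot)$ is a LIPL if and only if $y^{-1}x=x\cdot f_1(x,y)$. (u) $(xy)z=x\Leftrightarrow xz=[x/(xy)]x$. (v) $(Q,\cdot)$ is a RIPL if and only if $xy^{-1}=[x/(xy)]x$. (w) $(xy)z=x\Leftrightarrow xz=f_2(x,y)\cdot x$. (x) $(Q,\cdot)$ is a RIPL if and only if $xy^{-1}=f_2(x,y)\cdot x$.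
   Context: A loop $(Q,\cdot,\backslash,/)$ is a loop $(Q,\cdot)$ with identity $e$, where $x\backslash y$ is the unique $z$ with $x\cdot z=y$ and $x/y$ is the unique $z$ with $z\cdot y=x$. It is a middle Bol loop if $x((yz)\backslash x)=(x/z)(y\backslash x)$ for all $x,y,z$. In a middle Bol loop left and right inverses coincide; $x^{-1}$ denotes the two-sided inverse, and the two expressions given for each of $f_1,g_1,f_2,g_2$ agree. Items (e) and (f) mean: a map $Q^2\to Q$ is given by the first formula for all $x,y$ if and only if it is given by the second formula for all $x,y$. Translations act on the right: $yL_x=xy$, $yR_x=yx$, products of maps are composed left to right, and $I$ is the identity map. $(Q,/)\equiv(Q,\backslash)$ means $x/y=x\backslash y$ for all $x,y$. CIPL (cross inverse property loop): $(xy)x^{-1}=y$ for all $x,y$ (equivalently $x(yx^{-1})=y$, or $x^{-1}(yx)=y$, or $(x^{-1}y)x=y$). LIPL (left inverse property loop): $x^{-1}(xy)=y$ for all $x,y$. RIPL (right inverse property loop): $(yx)x^{-1}=y$ for all $x,y$. (There is no item (h).) *)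

theory Defs
  imports Main
begin

text \<open>
  Loops live on a whole type, so the underlying set is the (nonempty) type \<open>'a\<close>.
  The term \<open>x \<setminus> y\<close> is left division and \<open>x \<^bold>/ y\<close> right division.
\<close>

locale loop =
  fixes mult :: "'a \<Rightarrow> 'a \<Rightarrow> 'a" (infixl "\<cdot>" 70)
    and ldiv :: "'a \<Rightarrow> 'a \<Rightarrow> 'a" (infixl "\<setminus>" 70)
    and rdiv :: "'a \<Rightarrow> 'a \<Rightarrow> 'a" (infixl "\<^bold>'/" 70)
    and e :: 'a
  assumes left_id: "e \<cdot> x = x"
    and right_id: "x \<cdot> e = x"
    and ldiv_unique: "x \<cdot> z = y \<longleftrightarrow> z = x \<setminus> y"
    and rdiv_unique: "z \<cdot> y = x \<longleftrightarrow> z = x \<^bold>/ y"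

locale middle_bol_loop = loop +
  assumes middle_bol: "x \<cdot> ((y \<cdot> z) \<setminus> x) = (x \<^bold>/ z) \<cdot> (y \<setminus> x)"

text \<open>
  The two-sided inverse. In a general loop it need not exist; in a middle Bol loop it
  always does, see \<open>middle_bol_loop_inv\<close> below.
\<close>

definition loop_inv :: "('a \<Rightarrow> 'a \<Rightarrow> 'a) \<Rightarrow> 'a \<Rightarrow> 'a \<Rightarrow> 'a" where
  "loop_inv mult e x = (THE y. mult x y = e \<and> mult y x = e)"

lemma (in middle_bol_loop) middle_bol_loop_inv:
  "x \<cdot> loop_inv (\<cdot>) e x = e" "loop_inv (\<cdot>) e x \<cdot> x = e"
proof -
  have "e \<cdot> (x \<setminus> e) = (e \<^bold>/ x) \<cdot> (e \<setminus> e)"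
    using middle_bol[of e e x] by (simp add: left_id)
  moreover have "e \<setminus> e = e"
    using ldiv_unique left_id by metis
  ultimately have "x \<setminus> e = e \<^bold>/ x"
    by (simp add: left_id right_id)
  then have "x \<cdot> (x \<setminus> e) = e \<and> (x \<setminus> e) \<cdot> x = e"
    using ldiv_unique rdiv_unique by metis
  then have "x \<cdot> loop_inv (\<cdot>) e x = e \<and> loop_inv (\<cdot>) e x \<cdot> x = e"
    unfolding loop_inv_def by (rule theI) (use ldiv_unique in metis)
  then show "x \<cdot> loop_inv (\<cdot>) e x = e" "loop_inv (\<cdot>) e x \<cdot> x = e" by auto
qed

locale CIPL = loop +
  assumes cross_inverse: "(x \<cdot> y) \<cdot> loop_inv (\<cdot>) e x = y"

locale LIPL = loop +
  assumes left_inverse: "loop_inv (\<cdot>) e x \<cdot> (x \<cdot> y) = y"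

locale RIPL = loop +
  assumes right_inverse: "(y \<cdot> x) \<cdot> loop_inv (\<cdot>) e x = y"

text \<open>
  Translations are written as maps acting on the right in the source, so that a product
  of translations, composed left to right, is \<open>fcomp\<close>.
\<close>

definition left_trans :: "('a \<Rightarrow> 'a \<Rightarrow> 'a) \<Rightarrow> 'a \<Rightarrow> 'a \<Rightarrow> 'a" where
  "left_trans mult x = (\<lambda>y. mult x y)"

definition right_trans :: "('a \<Rightarrow> 'a \<Rightarrow> 'a) \<Rightarrow> 'a \<Rightarrow> 'a \<Rightarrow> 'a" where
  "right_trans mult x = (\<lambda>y. mult y x)"

end

theory Submission
  imports Defs
begin

text \<open>
  Setting \<open>y = e\<close>, \<open>y = x\<close> and \<open>z = x\<close> in the middle Bol identity gives
  \<^item> \<open>x \<cdot> (z \<setminus> x) = (x \<^bold>/ z) \<cdot> x\<close>,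
  \<^item> \<open>x \<cdot> ((x \<cdot> z) \<setminus> x) = x \<^bold>/ z\<close>,
  \<^item> \<open>x \<cdot> ((y \<cdot> x) \<setminus> x) = y \<setminus> x\<close>.

  The first one turns the other two into \<open>(x \<^bold>/ (x \<cdot> z)) \<cdot> x = x \<^bold>/ z\<close> and
  \<open>(x \<^bold>/ (y \<cdot> x)) \<cdot> x = y \<setminus> x\<close>. So a quotient of \<open>x\<close> by \<open>x \<cdot> y\<close> or \<open>y \<cdot> x\<close>, on
  either side, becomes the single quotient \<open>x \<^bold>/ y\<close> or \<open>y \<setminus> x\<close> once it is multiplied by \<open>x\<close>. Accordingly
  an equation such as \<open>(y \<cdot> x) \<cdot> z = x\<close> is solved for \<open>z\<close>, multiplied by \<open>x\<close>,
  and becomes \<open>x \<cdot> z = y \<setminus> x\<close>, that is, \<open>y \<cdot> (x \<cdot> z) = x\<close>; the laws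
  that move the brackets in such an equation all arise in this way.

  The inverse properties are the same equations with an inverse as the outer factor: taking
  the inverse of \<open>y\<close> for \<open>z\<close> turns \<open>(y \<cdot> x) \<cdot> z = x\<close> into the cross inverse law and
  \<open>z \<cdot> (y \<cdot> x) = x\<close> and \<open>(x \<cdot> y) \<cdot> z = x\<close> into the left and right ones. Each therefore says
  that a division by \<open>y\<close> is a multiplication by the inverse of \<open>y\<close>.
\<close>

context loop
begin

lemma mult_ldiv [simp]: "x \<cdot> (x \<setminus> y) = y"
  using ldiv_unique by blast

lemma rdiv_mult [simp]: "(x \<^bold>/ y) \<cdot> y = x"
  using rdiv_unique by blast

lemma left_cancel: "x \<cdot> y = x \<cdot> z \<longleftrightarrow> y = z"
  by (metis ldiv_unique)

lemma right_cancel: "y \<cdot> x = z \<cdot> x \<longleftrightarrow> y = z"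
  by (metis rdiv_unique)

lemma ldiv_self: "x \<setminus> x = e"
  using ldiv_unique right_id by metis

lemma ldiv_id: "e \<setminus> x = x"
  using ldiv_unique left_id by metis

lemma rdiv_self: "x \<^bold>/ x = e"
  using rdiv_unique left_id by metis

lemma CIPL_iff: "CIPL (\<cdot>) (\<setminus>) (\<^bold>/) e \<longleftrightarrow> (\<forall>x y. (x \<cdot> y) \<cdot> loop_inv (\<cdot>) e x = y)"
  by (simp add: CIPL_def CIPL_axioms_def loop_axioms)

lemma LIPL_iff: "LIPL (\<cdot>) (\<setminus>) (\<^bold>/) e \<longleftrightarrow> (\<forall>x y. loop_inv (\<cdot>) e x \<cdot> (x \<cdot> y) = y)"
  by (simp add: LIPL_def LIPL_axioms_def loop_axioms)

lemma RIPL_iff: "RIPL (\<cdot>) (\<setminus>) (\<^bold>/) e \<longleftrightarrow> (\<forall>x y. (y \<cdot> x) \<cdot> loop_inv (\<cdot>) e x = y)"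
  by (auto simp: RIPL_def RIPL_axioms_def loop_axioms)

end

context middle_bol_loop
begin

text \<open>The case \<open>y = e\<close> of the middle Bol identity. It exchanges a left
  quotient of \<open>x\<close> for a right one, and so doubles the next two identities.\<close>

lemma mult_ldiv_eq_rdiv_mult: "x \<cdot> (z \<setminus> x) = (x \<^bold>/ z) \<cdot> x"
  using middle_bol[of x e z] by (simp add: left_id ldiv_id)

text \<open>The case \<open>y = x\<close>, where the last factor \<open>y \<setminus> x\<close> collapses to \<open>e\<close>.\<close>

lemma mult_ldiv_right_mult: "x \<cdot> ((x \<cdot> z) \<setminus> x) = x \<^bold>/ z"
  using middle_bol[of x x z] by (simp add: ldiv_self right_id)

text \<open>The case \<open>z = x\<close>, where the factor \<open>x \<^bold>/ z\<close> collapses to \<open>e\<close>.\<close>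

lemma mult_ldiv_left_mult: "x \<cdot> ((y \<cdot> x) \<setminus> x) = y \<setminus> x"
  using middle_bol[of x y x] by (simp add: rdiv_self left_id)

lemma rdiv_right_mult_mult: "(x \<^bold>/ (x \<cdot> z)) \<cdot> x = x \<^bold>/ z"
  by (metis mult_ldiv_eq_rdiv_mult mult_ldiv_right_mult)

lemma rdiv_left_mult_mult: "(x \<^bold>/ (y \<cdot> x)) \<cdot> x = y \<setminus> x"
  by (metis mult_ldiv_eq_rdiv_mult mult_ldiv_left_mult)

lemmas quotient_reductions =
  mult_ldiv_right_mult mult_ldiv_left_mult rdiv_right_mult_mult rdiv_left_mult_mult

lemma rdiv_right_mult: "x \<^bold>/ (x \<cdot> y) = (x \<^bold>/ y) \<^bold>/ x"
  using rdiv_right_mult_mult rdiv_unique by blast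

lemma rdiv_left_mult: "x \<^bold>/ (y \<cdot> x) = (y \<setminus> x) \<^bold>/ x"
  using rdiv_left_mult_mult rdiv_unique by blast

text \<open>The next four equivalences solve for the outer factor \<open>z\<close>, multiply by \<open>x\<close>, which loses
  nothing by cancellation, and recognise the resulting quotient.\<close>

lemma left_mult_mult_eq_iff: "(y \<cdot> x) \<cdot> z = x \<longleftrightarrow> x \<cdot> z = y \<setminus> x"
  by (metis ldiv_unique left_cancel mult_ldiv_left_mult)

lemma right_mult_mult_eq_iff: "(x \<cdot> y) \<cdot> z = x \<longleftrightarrow> x \<cdot> z = x \<^bold>/ y"
  by (metis ldiv_unique left_cancel mult_ldiv_right_mult)

lemma mult_left_mult_eq_iff: "z \<cdot> (y \<cdot> x) = x \<longleftrightarrow> z \<cdot> x = y \<setminus> x"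
  by (metis rdiv_unique right_cancel rdiv_left_mult_mult)

lemma mult_right_mult_eq_iff: "z \<cdot> (x \<cdot> y) = x \<longleftrightarrow> z \<cdot> x = x \<^bold>/ y"
  by (metis rdiv_unique right_cancel rdiv_right_mult_mult)

lemma exchange_left_left: "z \<cdot> (y \<cdot> x) = x \<longleftrightarrow> y \<cdot> (z \<cdot> x) = x"
  unfolding mult_left_mult_eq_iff[of z y x] by (rule ldiv_unique[symmetric])

lemma exchange_left_right: "(y \<cdot> x) \<cdot> z = x \<longleftrightarrow> y \<cdot> (x \<cdot> z) = x"
  unfolding left_mult_mult_eq_iff by (rule ldiv_unique[symmetric])

lemma inv_inv: "loop_inv (\<cdot>) e (loop_inv (\<cdot>) e x) = x"
  by (metis middle_bol_loop_inv ldiv_unique)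

lemma CIPL_iff_mult_inv: "CIPL (\<cdot>) (\<setminus>) (\<^bold>/) e \<longleftrightarrow> (\<forall>x y. x \<cdot> loop_inv (\<cdot>) e y = y \<setminus> x)"
  by (auto simp: CIPL_iff left_mult_mult_eq_iff)

text \<open>Taking an inverse for the outer variable of the cross inverse law, and using that
  inversion is an involution, puts the inverse on the left.\<close>

lemma CIPL_iff_inv_mult: "CIPL (\<cdot>) (\<setminus>) (\<^bold>/) e \<longleftrightarrow> (\<forall>x y. loop_inv (\<cdot>) e y \<cdot> x = x \<^bold>/ y)"
proof -
  have "CIPL (\<cdot>) (\<setminus>) (\<^bold>/) e \<longleftrightarrow> (\<forall>x y. (loop_inv (\<cdot>) e y \<cdot> x) \<cdot> y = x)"
    unfolding CIPL_iff by (metis inv_inv)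
  then show ?thesis
    by (simp add: rdiv_unique)
qed

lemma LIPL_iff_inv_mult: "LIPL (\<cdot>) (\<setminus>) (\<^bold>/) e \<longleftrightarrow> (\<forall>x y. loop_inv (\<cdot>) e y \<cdot> x = y \<setminus> x)"
  by (auto simp: LIPL_iff mult_left_mult_eq_iff)

lemma RIPL_iff_mult_inv: "RIPL (\<cdot>) (\<setminus>) (\<^bold>/) e \<longleftrightarrow> (\<forall>x y. x \<cdot> loop_inv (\<cdot>) e y = x \<^bold>/ y)"
  by (auto simp: RIPL_iff right_mult_mult_eq_iff)

lemma left_trans_fcomp_commute:
  "fcomp (left_trans (\<cdot>) y) (left_trans (\<cdot>) z) = id \<longleftrightarrow>
   fcomp (left_trans (\<cdot>) z) (left_trans (\<cdot>) y) = id"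
  by (simp add: fun_eq_iff left_trans_def exchange_left_left)

lemma right_left_trans_fcomp_commute:
  "fcomp (right_trans (\<cdot>) u) (left_trans (\<cdot>) y) = id \<longleftrightarrow>
   fcomp (left_trans (\<cdot>) y) (right_trans (\<cdot>) u) = id"
  by (simp add: fun_eq_iff left_trans_def right_trans_def exchange_left_right)

end

theorem theorem2p2:
  fixes mult :: "'a \<Rightarrow> 'a \<Rightarrow> 'a" (infixl "\<cdot>" 70)
    and ldiv :: "'a \<Rightarrow> 'a \<Rightarrow> 'a" (infixl "\<setminus>" 70)
    and rdiv :: "'a \<Rightarrow> 'a \<Rightarrow> 'a" (infixl "\<^bold>'/" 70)
    and e :: 'a
    and f1 g1 f2 g2 :: "'a \<Rightarrow> 'a \<Rightarrow> 'a"
  assumes mbl: "middle_bol_loop (\<cdot>) (\<setminus>) (\<^bold>/) e"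
    and f1: "f1 = (\<lambda>x y. (y \<cdot> x) \<setminus> x) \<or> f1 = (\<lambda>x y. x \<setminus> (y \<setminus> x))"
    and g1: "g1 = (\<lambda>x y. (x \<cdot> y) \<setminus> x) \<or> g1 = (\<lambda>x y. x \<setminus> (x \<^bold>/ y))"
    and f2: "f2 = (\<lambda>x y. x \<^bold>/ (x \<cdot> y)) \<or> f2 = (\<lambda>x y. (x \<^bold>/ y) \<^bold>/ x)"
    and g2: "g2 = (\<lambda>x y. x \<^bold>/ (y \<cdot> x)) \<or> g2 = (\<lambda>x y. (y \<setminus> x) \<^bold>/ x)"
  shows "\<comment> \<open>(a)\<close> (\<forall>x y. x \<^bold>/ (y \<cdot> x) = (y \<setminus> x) \<^bold>/ x) \<and>
    \<comment> \<open>(b)\<close> ((\<forall>x y z. z \<cdot> (y \<cdot> x) = x \<longleftrightarrow> y \<cdot> (z \<cdot> x) = x) \<and>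
          (\<forall>y z. fcomp (left_trans (\<cdot>) y) (left_trans (\<cdot>) z) = id \<longleftrightarrow>
                 fcomp (left_trans (\<cdot>) z) (left_trans (\<cdot>) y) = id)) \<and>
    \<comment> \<open>(c)\<close> (\<forall>x z. x \<^bold>/ (x \<cdot> z) = (x \<^bold>/ z) \<^bold>/ x) \<and>
    \<comment> \<open>(d)\<close> ((\<forall>x y u. (y \<cdot> x) \<cdot> u = x \<longleftrightarrow> y \<cdot> (x \<cdot> u) = x) \<and>
          (\<forall>y u. fcomp (right_trans (\<cdot>) u) (left_trans (\<cdot>) y) = id \<longleftrightarrow>
                 fcomp (left_trans (\<cdot>) y) (right_trans (\<cdot>) u) = id)) \<and>
    \<comment> \<open>(e)\<close> (\<forall>h :: 'a \<Rightarrow> 'a \<Rightarrow> 'a.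
          (\<forall>x y. h x y = x \<^bold>/ (x \<cdot> y)) \<longleftrightarrow> (\<forall>x y. h x y = (x \<^bold>/ y) \<^bold>/ x)) \<and>
    \<comment> \<open>(f)\<close> (\<forall>h :: 'a \<Rightarrow> 'a \<Rightarrow> 'a.
          (\<forall>x y. h x y = x \<^bold>/ (y \<cdot> x)) \<longleftrightarrow> (\<forall>x y. h x y = (y \<setminus> x) \<^bold>/ x)) \<and>
    \<comment> \<open>(g)\<close> (((\<forall>x y. x \<^bold>/ y = x \<setminus> y) \<longleftrightarrow>
                 (\<forall>x y. (x \<^bold>/ (x \<cdot> y)) \<cdot> x = (y \<^bold>/ (x \<cdot> y)) \<cdot> y)) \<and>
          ((\<forall>x y. x \<^bold>/ y = x \<setminus> y) \<longleftrightarrow>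
                 (\<forall>x y. x \<cdot> ((x \<cdot> y) \<setminus> x) = (y \<^bold>/ (x \<cdot> y)) \<cdot> y)) \<and>
          ((\<forall>x y. x \<^bold>/ y = x \<setminus> y) \<longleftrightarrow>
                 (\<forall>x y. (x \<^bold>/ (x \<cdot> y)) \<cdot> x = y \<cdot> ((x \<cdot> y) \<setminus> y))) \<and>
          ((\<forall>x y. x \<^bold>/ y = x \<setminus> y) \<longleftrightarrow>
                 (\<forall>x y. x \<cdot> ((x \<cdot> y) \<setminus> x) = y \<cdot> ((x \<cdot> y) \<setminus> y)))) \<and>
    \<comment> \<open>(i)\<close> (\<forall>x y z. ((y \<cdot> x) \<cdot> z = x \<longleftrightarrow> x \<cdot> z = (x \<^bold>/ (y \<cdot> x)) \<cdot> x) \<and>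
          (x \<cdot> z = (x \<^bold>/ (y \<cdot> x)) \<cdot> x \<longleftrightarrow> y \<cdot> (x \<cdot> z) = x)) \<and>
    \<comment> \<open>(j)\<close> (CIPL (\<cdot>) (\<setminus>) (\<^bold>/) e \<longleftrightarrow>
          (\<forall>x y. x \<cdot> loop_inv (\<cdot>) e y = (x \<^bold>/ (y \<cdot> x)) \<cdot> x)) \<and>
    \<comment> \<open>(k)\<close> (\<forall>x y z. ((y \<cdot> x) \<cdot> z = x \<longleftrightarrow> x \<cdot> z = g2 x y \<cdot> x) \<and>
          (x \<cdot> z = g2 x y \<cdot> x \<longleftrightarrow> y \<cdot> (x \<cdot> z) = x)) \<and>
    \<comment> \<open>(l)\<close> (CIPL (\<cdot>) (\<setminus>) (\<^bold>/) e \<longleftrightarrow>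
          (\<forall>x y. x \<cdot> loop_inv (\<cdot>) e y = g2 x y \<cdot> x)) \<and>
    \<comment> \<open>(m)\<close> (\<forall>x y z. (z \<cdot> (x \<cdot> y) = x \<longleftrightarrow> z \<cdot> x = x \<cdot> ((x \<cdot> y) \<setminus> x)) \<and>
          (z \<cdot> x = x \<cdot> ((x \<cdot> y) \<setminus> x) \<longleftrightarrow> (z \<cdot> x) \<cdot> y = x)) \<and>
    \<comment> \<open>(n)\<close> (CIPL (\<cdot>) (\<setminus>) (\<^bold>/) e \<longleftrightarrow>
          (\<forall>x y. loop_inv (\<cdot>) e y \<cdot> x = x \<cdot> ((x \<cdot> y) \<setminus> x))) \<and>
    \<comment> \<open>(o)\<close> (\<forall>x y z. z \<cdot> (x \<cdot> y) = x \<longleftrightarrow> z \<cdot> x = x \<cdot> g1 x y) \<and>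
    \<comment> \<open>(p)\<close> (CIPL (\<cdot>) (\<setminus>) (\<^bold>/) e \<longleftrightarrow>
          (\<forall>x y. loop_inv (\<cdot>) e y \<cdot> x = x \<cdot> g1 x y)) \<and>
    \<comment> \<open>(q)\<close> (\<forall>x y z. (z \<cdot> (y \<cdot> x) = x \<longleftrightarrow> z \<cdot> x = x \<cdot> ((y \<cdot> x) \<setminus> x)) \<and>
          (z \<cdot> x = x \<cdot> ((y \<cdot> x) \<setminus> x) \<longleftrightarrow> y \<cdot> (z \<cdot> x) = x)) \<and>
    \<comment> \<open>(r)\<close> (LIPL (\<cdot>) (\<setminus>) (\<^bold>/) e \<longleftrightarrow>
          (\<forall>x y. loop_inv (\<cdot>) e y \<cdot> x = x \<cdot> ((y \<cdot> x) \<setminus> x))) \<and>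
    \<comment> \<open>(s)\<close> (\<forall>x y z. z \<cdot> (y \<cdot> x) = x \<longleftrightarrow> z \<cdot> x = x \<cdot> f1 x y) \<and>
    \<comment> \<open>(t)\<close> (LIPL (\<cdot>) (\<setminus>) (\<^bold>/) e \<longleftrightarrow>
          (\<forall>x y. loop_inv (\<cdot>) e y \<cdot> x = x \<cdot> f1 x y)) \<and>
    \<comment> \<open>(u)\<close> (\<forall>x y z. (x \<cdot> y) \<cdot> z = x \<longleftrightarrow> x \<cdot> z = (x \<^bold>/ (x \<cdot> y)) \<cdot> x) \<and>
    \<comment> \<open>(v)\<close> (RIPL (\<cdot>) (\<setminus>) (\<^bold>/) e \<longleftrightarrow>
          (\<forall>x y. x \<cdot> loop_inv (\<cdot>) e y = (x \<^bold>/ (x \<cdot> y)) \<cdot> x)) \<and>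
    \<comment> \<open>(w)\<close> (\<forall>x y z. (x \<cdot> y) \<cdot> z = x \<longleftrightarrow> x \<cdot> z = f2 x y \<cdot> x) \<and>
    \<comment> \<open>(x)\<close> (RIPL (\<cdot>) (\<setminus>) (\<^bold>/) e \<longleftrightarrow>
          (\<forall>x y. x \<cdot> loop_inv (\<cdot>) e y = f2 x y \<cdot> x))"
proof -
  interpret middle_bol_loop "(\<cdot>)" "(\<setminus>)" "(\<^bold>/)" e
    by (rule mbl)
  have f1': "x \<cdot> f1 x y = y \<setminus> x" for x y
    using f1 by (auto simp: quotient_reductions)
  have g1': "x \<cdot> g1 x y = x \<^bold>/ y" for x y
    using g1 by (auto simp: quotient_reductions)
  have f2': "f2 x y \<cdot> x = x \<^bold>/ y" for x y
    using f2 by (auto simp: quotient_reductions)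
  have g2': "g2 x y \<cdot> x = y \<setminus> x" for x y
    using g2 by (auto simp: quotient_reductions)
  (* Reducing every product to a plain quotient makes each item one of the laws above;
     the four identities compared with x / y = x \<setminus> y become that equation itself. *)
  show ?thesis
    unfolding quotient_reductions f1' g1' f2' g2'
      CIPL_iff_mult_inv[symmetric] CIPL_iff_inv_mult[symmetric]
      LIPL_iff_inv_mult[symmetric] RIPL_iff_mult_inv[symmetric]
    by (intro conjI allI rdiv_left_mult rdiv_right_mult exchange_left_left exchange_left_right
        left_trans_fcomp_commute right_left_trans_fcomp_commute
        left_mult_mult_eq_iff right_mult_mult_eq_iff mult_left_mult_eq_iff
        mult_right_mult_eq_iff ldiv_unique[symmetric] rdiv_unique[symmetric] refl;
        simp add: rdiv_left_mult rdiv_right_mult)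
qed

end
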